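(* Let $\mathcal G=(V,\ell,d,o)$ be a finite concurrent game structure and let $(\varphi,\eta)$ be a social law with $\varphi\in\mathsf{ATL}$ and $\eta:\mathrm{Act}\times\mathrm{Ag}\to 2^V$ a (reasonable) behavioural constraint. Let $(p_v)_{v\in V}$ be pairwise distinct atomic propositions such that each $p_v$ does not occur in $\varphi$ and $p_v\notin\ell(u)$ for all $u\ne v$. Let $\mathcal G^+$ be $\mathcal G$ with labelling $\ell^+(v)=\ell(v)\cup\{p_v\}$, and let $\pi_\eta$ be the update consisting of all items $p_v:\alpha\to\{a\}$ with $v\in\eta(\alpha,a)$ ($v\in V$, $\alpha\in\mathrm{Act}$, $a\in\mathrm{Ag}$). Then for every state $v\in V$, the social law is effective at $v$, i.e. $\mathcal G\dagger\eta, v\models\langle\langle\emptyset\rangle\rangle\mathbf G\varphi$, if and only if $\mathcal G^+,v\models[\pi_\eta]^-\langle\langle\emptyset\rangle\rangle\mathbf G\varphi$.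
   Context: $\mathrm{Ag}$ and $\mathrm{Act}$ are finite sets of agents and actions, $\mathrm{AP}$ is a countably infinite set of atomic propositions. **Syntax.** $\mathsf{ATL}$: $\varphi ::= p \mid \neg\varphi \mid (\varphi\lor\varphi) \mid \langle\langle A\rangle\rangle \mathbf{X}\varphi \mid \langle\langle A\rangle\rangle \varphi\,\mathbf{U}\,\varphi \mid \langle\langle A\rangle\rangle \varphi\,\mathbf{R}\,\varphi$, where $p\in\mathrm{AP}$, $A\subseteq\mathrm{Ag}$. $\mathsf{ATLD}^-$ adds $has(a,\alpha)$ and $[\pi]^-\varphi$, where $\pi$ is a finite list $\varphi_1:\alpha_1\to A_1,\dots,\varphi_k:\alpha_k\to A_k$ of items with $\varphi_i$ a formula, $\alpha_i\in\mathrm{Act}$, $A_i\subseteq\mathrm{Ag}$ (with the empty list acting as no update). $\langle\langle A\rangle\rangle\mathbf G\varphi$ abbreviates $\langle\langle A\rangle\rangle\bot\,\mathbf R\,\varphi$. **Models.** A concurrent game structure (CGS) is $\mathcal G=(V,\ell,d,o)$ with $V$ a finite set of states, $\ell:V\to 2^{\mathrm{AP}}$, $d:\mathrm{Ag}\times V\to 2^{\mathrm{Act}}\setminus\{\emptyset\}$ (available actions), and $o:V\times\mathrm{Act}^{\mathrm{Ag}}\to V$ (total). It is finite if its size is finite; in particular every $\ell(v)$ is finite. A path is an infinite sequence $\lambda=\lambda_0\lambda_1\dots$ of states such that for each $i$ there is $\mathbf c\in\prod_{a\in \mathrm{Ag}} d(a,\lambda_i)$ with $o(\lambda_i,\mathbf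 c)=\lambda_{i+1}$. A memoryless strategy of $a$ is $\sigma_a:V\to\mathrm{Act}$ with $\sigma_a(v)\in d(a,v)$ for all $v$. A strategy profile $\sigma_A$ of $A\subseteq\mathrm{Ag}$ consists of one strategy for each $a\in A$. $\mathrm{out}(v,\sigma_A)$ is the set of paths $\lambda$ with $\lambda_0=v$ such that for each $i$ there is $\mathbf c\in\prod_{a\in \mathrm{Ag}} d(a,\lambda_i)$ with $\mathbf c_a=\sigma_a(\lambda_i)$ for all $a\in A$ and $o(\lambda_i,\mathbf c)=\lambda_{i+1}$ (for $A=\emptyset$: all paths from $v$). **Semantics.** $\mathcal G,v\models p$ iff $p\in\ell(v)$; Boolean connectives as usual. $\mathcal G,v\models\langle\langle A\rangle\rangle\mathbf X\varphi$ iff there is $\sigma_A$ such that for all $\lambda\in\mathrm{out}(v,\sigma_A)$: $\mathcal G,\lambda_1\models\varphi$. $\mathcal G,v\models\langle\langle A\rangle\rangle\varphi\,\mathbf U\,\psi$ iff there is $\sigma_A$ such that for all $\lambda\in\mathrm{out}(v,\sigma_A)$ there is $i\ge 0$ with $\mathcal G,\lambda_i\models\psi$ and $\mathcal G,\lambda_j\models\varphi$ for all $0\le j<i$. $\mathcal G,v\models\langle\langle A\rangle\rangle\varphi\,\mathbf R\,\psi$ iff there is $\sigma_A$ such that for all $\lambda\in\mathrm{out}(v,\sigma_A)$ and all $k\ge0$: $\mathcal G,\lambda_k\models\psi$ or there is $0\le j<k$ with $\mathcal G,\lambda_j\models\varphi$. $\mathcal G,v\models has(a,\alpha)$ iff $\alpha\in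 d(a,v)$. For $\pi=\varphi_1:\alpha_1\to A_1,\dots,\varphi_k:\alpha_k\to A_k$ put $upd^\pi(a,v')=\{\alpha_i\mid 1\le i\le k,\ \mathcal G,v'\models\varphi_i,\ a\in A_i\}$. $\mathcal G,v\models[\pi]^-\psi$ iff $(V,\ell,d',o),v\models\psi$ where for all $a,v'$, $d'(a,v')=d(a,v')\setminus upd^\pi(a,v')$ if $d(a,v')\not\subseteq upd^\pi(a,v')$, and $d'(a,v')=d(a,v')$ otherwise. **Social laws.** A behavioural constraint on $\mathcal G$ is a function $\eta:\mathrm{Act}\times\mathrm{Ag}\to2^V$; $v\in\eta(\alpha,a)$ means $a$ is not allowed to perform $\alpha$ in $v$. It must be reasonable: for all $a\in\mathrm{Ag}$, $v\in V$ there is $\alpha\in d(a,v)$ with $v\notin\eta(\alpha,a)$. The implementation $\mathcal G\dagger\eta$ is the CGS obtained by removing all transitions that involve prohibited actions, i.e. $(V,\ell,d_\eta,o)$ with $d_\eta(a,v)=d(a,v)\setminus\{\alpha\mid v\in\eta(\alpha,a)\}$. A social law is a pair $(\varphi,\eta)$ of a goal formula and a behavioural constraint. *)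

theory Defs
  imports
    Main
    "HOL-Library.Countable"
    "HOL-Library.Infinite_Typeclass"
begin

(* Agents, actions and atomic propositions are the types 'ag, 'act and 'ap. *)

datatype (atoms: 'ap, 'act, dead 'ag) fm =
    Atom 'ap
  | Neg "('ap, 'act, 'ag) fm"
  | Or "('ap, 'act, 'ag) fm" "('ap, 'act, 'ag) fm"
  | Next "'ag set" "('ap, 'act, 'ag) fm"
  | Until "'ag set" "('ap, 'act, 'ag) fm" "('ap, 'act, 'ag) fm"
  | Release "'ag set" "('ap, 'act, 'ag) fm" "('ap, 'act, 'ag) fm"
  | Has 'ag 'act
  | Update "(('ap, 'act, 'ag) fm \<times> 'act \<times> 'ag set) list" "('ap, 'act, 'ag) fm"

primrec is_ATL :: "('ap, 'act, 'ag) fm \<Rightarrow> bool" where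
  "is_ATL (Atom p) \<longleftrightarrow> True"
| "is_ATL (Neg \<phi>) \<longleftrightarrow> is_ATL \<phi>"
| "is_ATL (Or \<phi> \<psi>) \<longleftrightarrow> is_ATL \<phi> \<and> is_ATL \<psi>"
| "is_ATL (Next A \<phi>) \<longleftrightarrow> is_ATL \<phi>"
| "is_ATL (Until A \<phi> \<psi>) \<longleftrightarrow> is_ATL \<phi> \<and> is_ATL \<psi>"
| "is_ATL (Release A \<phi> \<psi>) \<longleftrightarrow> is_ATL \<phi> \<and> is_ATL \<psi>"
| "is_ATL (Has a \<alpha>) \<longleftrightarrow> False"
| "is_ATL (Update \<pi> \<phi>) \<longleftrightarrow> False"

(* The grammar has no constant for falsity, so it is expressed with an arbitrary fixed atom,
   whose choice does not affect the truth value. *)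
definition Falsum :: "('ap, 'act, 'ag) fm" where
  "Falsum = Neg (Or (Atom undefined) (Neg (Atom undefined)))"

definition Globally :: "'ag set \<Rightarrow> ('ap, 'act, 'ag) fm \<Rightarrow> ('ap, 'act, 'ag) fm" where
  "Globally A \<phi> = Release A Falsum \<phi>"

(* Only the values of label, avail and outcome at members of states are meaningful. *)
record ('v, 'ap, 'act, 'ag) cgs =
  states :: "'v set"
  label :: "'v \<Rightarrow> 'ap set"
  avail :: "'ag \<Rightarrow> 'v \<Rightarrow> 'act set"
  outcome :: "'v \<Rightarrow> ('ag \<Rightarrow> 'act) \<Rightarrow> 'v"

definition is_cgs :: "('v, 'ap, 'act, 'ag) cgs \<Rightarrow> bool" where
  "is_cgs G \<longleftrightarrow> finite (states G) \<and>
     (\<forall>a. \<forall>v\<in>states G. avail G a v \<noteq> {}) \<and>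
     (\<forall>v\<in>states G. \<forall>c. outcome G v c \<in> states G)"

definition finite_cgs :: "('v, 'ap, 'act, 'ag) cgs \<Rightarrow> bool" where
  "finite_cgs G \<longleftrightarrow> is_cgs G \<and> (\<forall>v\<in>states G. finite (label G v))"

definition is_path :: "('v, 'ap, 'act, 'ag) cgs \<Rightarrow> (nat \<Rightarrow> 'v) \<Rightarrow> bool" where
  "is_path G \<rho> \<longleftrightarrow> (\<forall>i. \<rho> i \<in> states G \<and>
     (\<exists>c. (\<forall>a. c a \<in> avail G a (\<rho> i)) \<and> outcome G (\<rho> i) c = \<rho> (Suc i)))"

definition is_strategy :: "('v, 'ap, 'act, 'ag) cgs \<Rightarrow> 'ag \<Rightarrow> ('v \<Rightarrow> 'act) \<Rightarrow> bool" where
  "is_strategy G a s \<longleftrightarrow> (\<forall>v\<in>states G. s v \<in> avail G a v)"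

(* A profile for A is a function on all agents whose values outside A are ignored. *)
definition is_profile :: "('v, 'ap, 'act, 'ag) cgs \<Rightarrow> 'ag set \<Rightarrow> ('ag \<Rightarrow> 'v \<Rightarrow> 'act) \<Rightarrow> bool" where
  "is_profile G A \<sigma> \<longleftrightarrow> (\<forall>a\<in>A. is_strategy G a (\<sigma> a))"

definition out ::
  "('v, 'ap, 'act, 'ag) cgs \<Rightarrow> 'v \<Rightarrow> 'ag set \<Rightarrow> ('ag \<Rightarrow> 'v \<Rightarrow> 'act) \<Rightarrow> (nat \<Rightarrow> 'v) set" where
  "out G v A \<sigma> = {\<rho>. is_path G \<rho> \<and> \<rho> 0 = v \<and>
     (\<forall>i. \<exists>c. (\<forall>a. c a \<in> avail G a (\<rho> i)) \<and> (\<forall>a\<in>A. c a = \<sigma> a (\<rho> i)) \<and>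
              outcome G (\<rho> i) c = \<rho> (Suc i))}"

definition revoke ::
  "('v, 'ap, 'act, 'ag) cgs \<Rightarrow> ('ag \<Rightarrow> 'v \<Rightarrow> 'act set) \<Rightarrow> ('v, 'ap, 'act, 'ag) cgs" where
  "revoke G U = G\<lparr>avail := (\<lambda>a v.
     if avail G a v \<subseteq> U a v then avail G a v else avail G a v - U a v)\<rparr>"

lemma size_update_item [termination_simp]:
  "(\<phi>, \<alpha>, A) \<in> set \<pi> \<Longrightarrow>
    size \<phi> < Suc (size_list (size_prod size f) \<pi> + n)"
  by (induction \<pi>) auto

function (sequential) sat ::
  "('v, 'ap, 'act, 'ag) cgs \<Rightarrow> 'v \<Rightarrow> ('ap, 'act, 'ag) fm \<Rightarrow> bool" where
  "sat G v (Atom p) \<longleftrightarrow> p \<in> label G v"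
| "sat G v (Neg \<phi>) \<longleftrightarrow> \<not> sat G v \<phi>"
| "sat G v (Or \<phi> \<psi>) \<longleftrightarrow> sat G v \<phi> \<or> sat G v \<psi>"
| "sat G v (Next A \<phi>) \<longleftrightarrow>
     (\<exists>\<sigma>. is_profile G A \<sigma> \<and> (\<forall>\<rho>\<in>out G v A \<sigma>. sat G (\<rho> 1) \<phi>))"
| "sat G v (Until A \<phi> \<psi>) \<longleftrightarrow>
     (\<exists>\<sigma>. is_profile G A \<sigma> \<and> (\<forall>\<rho>\<in>out G v A \<sigma>.
        \<exists>i. sat G (\<rho> i) \<psi> \<and> (\<forall>j<i. sat G (\<rho> j) \<phi>)))"
| "sat G v (Release A \<phi> \<psi>) \<longleftrightarrow>
     (\<exists>\<sigma>. is_profile G A \<sigma> \<and> (\<forall>\<rho>\<in>out G v A \<sigma>.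
        \<forall>k. sat G (\<rho> k) \<psi> \<or> (\<exists>j<k. sat G (\<rho> j) \<phi>)))"
| "sat G v (Has a \<alpha>) \<longleftrightarrow> \<alpha> \<in> avail G a v"
| "sat G v (Update \<pi> \<psi>) \<longleftrightarrow>
     sat (revoke G (\<lambda>a v'. {\<alpha>. \<exists>(\<phi>, \<beta>, A)\<in>set \<pi>. \<beta> = \<alpha> \<and> sat G v' \<phi> \<and> a \<in> A})) v \<psi>"
  by pat_completeness auto
termination
  by (relation "measure (\<lambda>(G, v, \<phi>). size \<phi>)") (auto intro: size_update_item)

definition behavioural_constraint ::
  "('v, 'ap, 'act, 'ag) cgs \<Rightarrow> ('act \<Rightarrow> 'ag \<Rightarrow> 'v set) \<Rightarrow> bool" where
  "behavioural_constraint G \<eta> \<longleftrightarrow> (\<forall>\<alpha> a. \<eta> \<alpha> a \<subseteq> states G) \<and>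
     (\<forall>a. \<forall>v\<in>states G. \<exists>\<alpha>\<in>avail G a v. v \<notin> \<eta> \<alpha> a)"

definition implementation ::
  "('v, 'ap, 'act, 'ag) cgs \<Rightarrow> ('act \<Rightarrow> 'ag \<Rightarrow> 'v set) \<Rightarrow> ('v, 'ap, 'act, 'ag) cgs"
  (infixl "\<dagger>" 65) where
  "G \<dagger> \<eta> = G\<lparr>avail := (\<lambda>a v. avail G a v - {\<alpha>. v \<in> \<eta> \<alpha> a})\<rparr>"

definition effective_at ::
  "('v, 'ap, 'act, 'ag) cgs \<Rightarrow> ('ap, 'act, 'ag) fm \<Rightarrow> ('act \<Rightarrow> 'ag \<Rightarrow> 'v set) \<Rightarrow> 'v \<Rightarrow> bool" where
  "effective_at G \<phi> \<eta> v \<longleftrightarrow> sat (G \<dagger> \<eta>) v (Globally {} \<phi>)"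

definition add_markers ::
  "('v, 'ap, 'act, 'ag) cgs \<Rightarrow> ('v \<Rightarrow> 'ap) \<Rightarrow> ('v, 'ap, 'act, 'ag) cgs" where
  "add_markers G p = G\<lparr>label := (\<lambda>v. label G v \<union> {p v})\<rparr>"

end

theory Submission
  imports Defs
begin

text \<open>
  The markers name the states, so \<open>\<pi>\<close> revokes exactly the actions
  prohibited by \<open>\<eta>\<close>; reasonableness of \<open>\<eta>\<close> means that the guard
  against revoking every action of an agent never fires. Hence the updated structure and the
  implementation have the same paths and strategies and differ only in the labelling by
  the markers, which the goal formula cannot see.
\<close>

text \<open>Agreement is required only at \<open>states H\<close>, since the two structures compared
  in the end can differ elsewhere: a state outside \<open>states G\<close> may carry a marker of one
  inside. Labels are left to a separate condition relative to a formula.\<close>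

definition same_frame ::
  "('v, 'ap, 'act, 'ag) cgs \<Rightarrow> ('v, 'ap, 'act, 'ag) cgs \<Rightarrow> bool" where
  "same_frame G H \<longleftrightarrow> states G = states H \<and>
     (\<forall>v\<in>states H. outcome G v = outcome H v \<and> (\<forall>a. avail G a v = avail H a v))"

lemma is_profile_cong: "same_frame G H \<Longrightarrow> is_profile G = is_profile H"
  by (auto simp: same_frame_def is_profile_def is_strategy_def fun_eq_iff)

lemma out_cong:
  assumes "same_frame G H"
  shows "out G = out H"
proof -
  have "\<rho> \<in> out G v A \<sigma> \<longleftrightarrow> \<rho> \<in> out H v A \<sigma>" for v A \<sigma> \<rho>
  \<comment> \<open>A sequence leaving \<open>states H\<close> is a path of neither structure; along
    any other, the data that define \<open>out\<close> coincide position by position.\<close>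
  proof (cases "range \<rho> \<subseteq> states H")
    case True
    then have "\<rho> i \<in> states H" for i
      by auto
    then have "outcome G (\<rho> i) = outcome H (\<rho> i)" "avail G a (\<rho> i) = avail H a (\<rho> i)" for i a
      using assms by (simp_all add: same_frame_def)
    moreover have "states G = states H"
      using assms by (simp add: same_frame_def)
    ultimately show ?thesis
      by (simp add: out_def is_path_def)
  next
    case False
    then show ?thesis
      using assms by (auto simp: out_def is_path_def same_frame_def)
  qed
  then show ?thesis
    by (intro ext set_eqI)
qed

lemma out_states: "\<rho> \<in> out G v A \<sigma> \<Longrightarrow> \<rho> i \<in> states G"
  by (simp add: out_def is_path_def)

text \<open>Coincidence lemma: evaluation at a state consults only the frame and the labels
  restricted to the atoms of the formula. The induction generalises over \<open>G\<close> and
  \<open>H\<close> because an update replaces both structures.\<close>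

lemma sat_cong:
  assumes "same_frame G H" "\<And>v. v \<in> states H \<Longrightarrow> label G v \<inter> atoms \<phi> = label H v \<inter> atoms \<phi>"
    and "v \<in> states H"
  shows "sat G v \<phi> \<longleftrightarrow> sat H v \<phi>"
  using assms
proof (induction \<phi> arbitrary: G H v)
  case (Atom q)
  then show ?case by force
next
  case (Neg \<phi>)
  then show ?case by simp
next
  case (Or \<phi> \<psi>)
  have "label G v \<inter> atoms \<phi> = label H v \<inter> atoms \<phi>" "label G v \<inter> atoms \<psi> = label H v \<inter> atoms \<psi>"
    if "v \<in> states H" for v
    using Or.prems(2)[OF that] by auto
  then show ?case
    using Or.IH[OF Or.prems(1) _ Or.prems(3)] by simp
next
  case (Next A \<phi>)
  have "sat G w \<phi> \<longleftrightarrow> sat H w \<phi>" if "w \<in> states H" for w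
    using Next.IH[OF Next.prems(1) _ that] Next.prems(2) by simp
  \<comment> \<open>Outcome paths stay in \<open>states H\<close>, where the induction hypothesis
    applies; \<open>ball_cong\<close> then supplies membership in \<open>out\<close> when rewriting
    under the path quantifier.\<close>
  then have "sat G (\<rho> i) \<phi> \<longleftrightarrow> sat H (\<rho> i) \<phi>" if "\<rho> \<in> out H v A \<sigma>" for \<rho> \<sigma> i
    using out_states[OF that] by simp_all
  then show ?case
    by (simp add: is_profile_cong[OF Next.prems(1)] out_cong[OF Next.prems(1)] cong: ball_cong)
next
  case (Until A \<phi> \<psi>)
  have "label G v \<inter> atoms \<phi> = label H v \<inter> atoms \<phi>" "label G v \<inter> atoms \<psi> = label H v \<inter> atoms \<psi>"
    if "v \<in> states H" for v
    using Until.prems(2)[OF that] by auto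
  then have "sat G w \<phi> \<longleftrightarrow> sat H w \<phi>" "sat G w \<psi> \<longleftrightarrow> sat H w \<psi>" if "w \<in> states H" for w
    using Until.IH[OF Until.prems(1) _ that] by simp_all
  then have "sat G (\<rho> i) \<phi> \<longleftrightarrow> sat H (\<rho> i) \<phi>" "sat G (\<rho> i) \<psi> \<longleftrightarrow> sat H (\<rho> i) \<psi>"
    if "\<rho> \<in> out H v A \<sigma>" for \<rho> \<sigma> i
    using out_states[OF that] by simp_all
  then show ?case
    by (simp add: is_profile_cong[OF Until.prems(1)] out_cong[OF Until.prems(1)] cong: ball_cong)
next
  case (Release A \<phi> \<psi>)
  have "label G v \<inter> atoms \<phi> = label H v \<inter> atoms \<phi>" "label G v \<inter> atoms \<psi> = label H v \<inter> atoms \<psi>"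
    if "v \<in> states H" for v
    using Release.prems(2)[OF that] by auto
  then have "sat G w \<phi> \<longleftrightarrow> sat H w \<phi>" "sat G w \<psi> \<longleftrightarrow> sat H w \<psi>" if "w \<in> states H" for w
    using Release.IH[OF Release.prems(1) _ that] by simp_all
  then have "sat G (\<rho> i) \<phi> \<longleftrightarrow> sat H (\<rho> i) \<phi>" "sat G (\<rho> i) \<psi> \<longleftrightarrow> sat H (\<rho> i) \<psi>"
    if "\<rho> \<in> out H v A \<sigma>" for \<rho> \<sigma> i
    using out_states[OF that] by simp_all
  then show ?case
    by (simp add: is_profile_cong[OF Release.prems(1)] out_cong[OF Release.prems(1)] cong: ball_cong)
next
  case (Has a \<alpha>)
  then show ?case by (simp add: same_frame_def)
next
  case (Update \<pi> \<psi>)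
  \<comment> \<open>Item formulas are evaluated before anything is revoked, so their hypothesis is
    used for \<open>G\<close> and \<open>H\<close> themselves, whereas the one for
    \<open>\<psi>\<close> is used for the revoked structures. The nesting through lists of triples
    introduces \<open>fsts\<close>.\<close>
  have item: "sat G w \<phi> \<longleftrightarrow> sat H w \<phi>" if "w \<in> states H" "(\<phi>, \<alpha>, A) \<in> set \<pi>" for w \<phi> \<alpha> A
  proof (rule Update.IH(1)[OF that(2) _ Update.prems(1) _ that(1)])
    show "\<phi> \<in> Basic_BNFs.fsts (\<phi>, \<alpha>, A)" by simp
    fix u assume "u \<in> states H"
    have "atoms \<phi> \<subseteq> atoms (Update \<pi> \<psi>)"
      using that(2) by (auto intro!: bexI[of _ "(\<phi>, \<alpha>, A)"])
    with Update.prems(2)[OF \<open>u \<in> states H\<close>]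
    show "label G u \<inter> atoms \<phi> = label H u \<inter> atoms \<phi>" by blast
  qed
  let ?U = "\<lambda>G a w. {\<alpha>. \<exists>(\<phi>, \<beta>, A)\<in>set \<pi>. \<beta> = \<alpha> \<and> sat G w \<phi> \<and> a \<in> A}"
  have "?U G a w = ?U H a w" if "w \<in> states H" for a w
    by (intro Collect_cong bex_cong refl) (auto simp: item[OF that])
  then have "same_frame (revoke G (?U G)) (revoke H (?U H))"
    using Update.prems(1) by (simp add: same_frame_def revoke_def)
  moreover have "label G u \<inter> atoms \<psi> = label H u \<inter> atoms \<psi>" if "u \<in> states H" for u
    using Update.prems(2)[OF that] by auto
  ultimately show ?case
    using Update.IH(2)[of "revoke G (?U G)" "revoke H (?U H)" v] Update.prems(3)
    by (simp add: revoke_def)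
qed

text \<open>Not an instance of \<open>sat_cong\<close>: the atom inside \<^const>\<open>Falsum\<close> may be one of the markers.\<close>

lemma sat_Globally_cong:
  assumes "same_frame G H" "\<And>v. v \<in> states H \<Longrightarrow> label G v \<inter> atoms \<phi> = label H v \<inter> atoms \<phi>"
  shows "sat G v (Globally A \<phi>) \<longleftrightarrow> sat H v (Globally A \<phi>)"
proof -
  have "sat G (\<rho> i) \<phi> \<longleftrightarrow> sat H (\<rho> i) \<phi>" if "\<rho> \<in> out H v A \<sigma>" for \<rho> \<sigma> i
    using sat_cong[OF assms] out_states[OF that] by simp
  then show ?thesis
    \<comment> \<open>Unfolded, \<open>Falsum\<close> negates an instance of excluded middle, so
      only the truth of \<open>\<phi>\<close> at every position of every outcome path is left to
      compare.\<close>
    by (simp add: Globally_def Falsum_def is_profile_cong[OF assms(1)] out_cong[OF assms(1)]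
        cong: ball_cong)
qed

theorem theorem3:
  fixes G :: "('v, 'ap :: {countable, infinite}, 'act :: finite, 'ag :: finite) cgs"
    and \<phi> :: "('ap, 'act, 'ag) fm"
    and \<eta> :: "'act \<Rightarrow> 'ag \<Rightarrow> 'v set"
    and p :: "'v \<Rightarrow> 'ap"
    and \<pi> :: "(('ap, 'act, 'ag) fm \<times> 'act \<times> 'ag set) list"
  assumes "finite_cgs G"
    and "is_ATL \<phi>"
    and "behavioural_constraint G \<eta>"
    and "inj_on p (states G)"
    and "\<forall>v\<in>states G. p v \<notin> atoms \<phi>"
    and "\<forall>v\<in>states G. \<forall>u\<in>states G. u \<noteq> v \<longrightarrow> p v \<notin> label G u"
    and "set \<pi> = {(Atom (p v), \<alpha>, {a}) | v \<alpha> a. v \<in> states G \<and> v \<in> \<eta> \<alpha> a}"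
  shows "\<forall>v\<in>states G.
    effective_at G \<phi> \<eta> v \<longleftrightarrow> sat (add_markers G p) v (Update \<pi> (Globally {} \<phi>))"
proof
  fix v
  \<comment> \<open>This is the set that the semantics of \<open>Update\<close> passes to
    \<open>revoke\<close>.\<close>
  define U where
    "U = (\<lambda>a v'. {\<alpha>. \<exists>(\<psi>, \<beta>, A)\<in>set \<pi>. \<beta> = \<alpha> \<and> sat (add_markers G p) v' \<psi> \<and> a \<in> A})"
  have U: "U a w = {\<alpha>. w \<in> \<eta> \<alpha> a}" if "w \<in> states G" for a w
  proof -
    \<comment> \<open>Two sources could make \<open>p u\<close> true at \<open>w\<close> for
      \<open>u\<close> other than \<open>w\<close>: the added label \<open>p w\<close>, excluded by
      injectivity, and the original label, excluded by freshness.\<close>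
    have marker: "sat (add_markers G p) w (Atom (p u)) \<longleftrightarrow> u = w" if "u \<in> states G" for u
      using that \<open>w \<in> states G\<close> assms(4,6) by (auto simp: add_markers_def dest: inj_onD)
    have "\<alpha> \<in> U a w \<longleftrightarrow>
        (\<exists>u\<in>states G. u \<in> \<eta> \<alpha> a \<and> sat (add_markers G p) w (Atom (p u)))" for \<alpha>
      unfolding U_def assms(7) by blast
    then show ?thesis
      \<comment> \<open>With \<open>sat.simps\<close> active, atoms would unfold to label membership
        and \<open>marker\<close> would no longer match.\<close>
      using that by (auto simp: marker simp del: sat.simps)
  qed
  have "\<not> avail G a w \<subseteq> {\<alpha>. w \<in> \<eta> \<alpha> a}" if "w \<in> states G" for a w
    using assms(3) that unfolding behavioural_constraint_def by blast
  then have "same_frame (G \<dagger> \<eta>) (revoke (add_markers G p) U)"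
    by (simp add: same_frame_def implementation_def revoke_def add_markers_def U)
  moreover have "label (G \<dagger> \<eta>) w \<inter> atoms \<phi> = label (revoke (add_markers G p) U) w \<inter> atoms \<phi>"
    if "w \<in> states (revoke (add_markers G p) U)" for w
    using that assms(5) by (simp add: implementation_def revoke_def add_markers_def)
  ultimately show "effective_at G \<phi> \<eta> v \<longleftrightarrow>
      sat (add_markers G p) v (Update \<pi> (Globally {} \<phi>))"
    unfolding effective_at_def sat.simps U_def by (rule sat_Globally_cong)
qed

end
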